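(* Let $\mu,\nu\in\mathcal M$ with $\mu(\mathbb R)\le\nu(\mathbb R)$. The second (distributional) derivative of $k\mapsto P_\nu(k)-(P_\nu-P_\mu)^c(k)$ corresponds to the unique measure $S^\nu(\mu)\in\mathcal T_{\mu,\nu}$ that satisfies $$P_{S^\nu(\mu)}(k)=P_\nu(k)-(P_\nu-P_\mu)^c(k)-p_{\mu,\nu},\quad k\in\mathbb R,\qquad\text{and}\qquad \overline{S^\nu(\mu)}=\overline\mu+p_{\mu,\nu}-c_{\mu,\nu}.$$
   Context: $\mathcal M$ is the set of Borel measures $\eta$ on $\mathbb R$ with $\eta(\mathbb R)<\infty$ and $\int|x|\,\eta(dx)<\infty$. For $\eta\in\mathcal M$: $\overline\eta=\int x\,\eta(dx)$ (not normalized), $P_\eta(k)=\int(k-x)^+\eta(dx)$, $C_\eta(k)=\int(x-k)^+\eta(dx)$. For $f:\mathbb R\to\mathbb R$, $f^c$ denotes the largest convex minorant (convex hull) of $f$. For $\mu,\nu\in\mathcal M$ with $\mu(\mathbb R)\le\nu(\mathbb R)$: $$\mathcal T_{\mu,\nu}=\{\theta\in\mathcal M:\theta(\mathbb R)=\mu(\mathbb R),\ \theta\le\nu\},\quad p_{\mu,\nu}=\sup_{k}\{P_\mu(k)-P_\nu(k)\},\quad c_{\mu,\nu}=\sup_{k}\{C_\mu(k)-C_\nu(k)\},$$ where $\theta\le\nu$ means $\theta(A)\le\nu(A)$ for all Borel $A$; $p_{\mu,\nu},c_{\mu,\nu}\in[0,\infty)$. The measure $S^\nu(\mu)$ is called the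 (generalized) shadow measure of $\mu$ in $\nu$. *)

theory Defs
  imports "HOL-Analysis.Analysis"
begin

definition finite_moment_measures :: "real measure set" (\<open>\<M>\<close>) where
  "\<M> = {\<eta>. sets \<eta> = sets borel \<and> finite_measure \<eta> \<and> (\<integral>\<^sup>+x. ennreal \<bar>x\<bar> \<partial>\<eta>) < \<infinity>}"

text \<open>The mean is not normalized by the total mass.\<close>

definition mean :: "real measure \<Rightarrow> real" where
  "mean \<eta> = (\<integral>x. x \<partial>\<eta>)"

definition put :: "real measure \<Rightarrow> real \<Rightarrow> real" where
  "put \<eta> k = (\<integral>x. max (k - x) 0 \<partial>\<eta>)"

definition call :: "real measure \<Rightarrow> real \<Rightarrow> real" where
  "call \<eta> k = (\<integral>x. max (x - k) 0 \<partial>\<eta>)"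

text \<open>
  The largest convex minorant, with respect to the pointwise order on functions.
  It is unspecified if the function has no convex minorant at all.
\<close>

definition convex_minorant :: "(real \<Rightarrow> real) \<Rightarrow> real \<Rightarrow> real" where
  "convex_minorant f = (GREATEST g. convex_on UNIV g \<and> g \<le> f)"

definition submeasures :: "real measure \<Rightarrow> real measure \<Rightarrow> real measure set" where
  "submeasures \<mu> \<nu> = {\<theta> \<in> \<M>. emeasure \<theta> UNIV = emeasure \<mu> UNIV \<and>
     (\<forall>A\<in>sets borel. emeasure \<theta> A \<le> emeasure \<nu> A)}"

definition put_gap :: "real measure \<Rightarrow> real measure \<Rightarrow> real" where
  "put_gap \<mu> \<nu> = (SUP k. put \<mu> k - put \<nu> k)"

definition call_gap :: "real measure \<Rightarrow> real measure \<Rightarrow> real" where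
  "call_gap \<mu> \<nu> = (SUP k. call \<mu> k - call \<nu> k)"

definition test_function :: "(real \<Rightarrow> real) \<Rightarrow> bool" where
  "test_function \<phi> \<longleftrightarrow>
     (\<forall>n. (deriv ^^ n) \<phi> differentiable_on UNIV) \<and> compact (closure {x. \<phi> x \<noteq> 0})"

text \<open>
  The second distributional derivative of the locally integrable function \<open>F\<close> is
  (the distribution induced by) the locally finite Borel measure \<open>\<theta>\<close>.
\<close>

definition has_second_distributional_derivative ::
    "(real \<Rightarrow> real) \<Rightarrow> real measure \<Rightarrow> bool" where
  "has_second_distributional_derivative F \<theta> \<longleftrightarrow>
     (\<forall>a b. set_integrable lborel {a..b} F) \<and>
     sets \<theta> = sets borel \<and> (\<forall>K. compact K \<longrightarrow> emeasure \<theta> K < \<infinity>) \<and>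
     (\<forall>\<phi>. test_function \<phi> \<longrightarrow>
        (\<integral>x. F x * (deriv ^^ 2) \<phi> x \<partial>lborel) = (\<integral>x. \<phi> x \<partial>\<theta>))"

end

theory Submission
  imports Defs "HOL-Probability.Distribution_Functions"
begin

text \<open>
  Write \<open>D = put \<nu> - put \<mu>\<close>, let \<open>c\<close> be its largest convex minorant, and let \<open>p\<close> and \<open>q\<close> be the put
  gap and the call gap. The heart of the matter is that \<open>put \<nu> - c\<close> is again convex, although a
  difference of convex functions usually is not
  (\<open>convex_on_minus_convex_minorant\<close>). If it failed to stay below one of its chords \<open>l\<close> on
  \<open>[a, b]\<close>, then replacing \<open>c\<close> by \<open>max c (put \<nu> - l)\<close> on \<open>[a, b]\<close> would give a larger
  convex function, still below \<open>D\<close>: the function \<open>put \<mu> \<le> put \<nu> - c\<close> is convex, hence below \<open>l\<close> on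
  \<open>[a, b]\<close>. This contradicts maximality.

  A convex function that vanishes at \<open>-\<infinity>\<close> and has an asymptote \<open>m * k - b\<close> at \<open>\<infinity>\<close> is the put function
  of a measure of mass \<open>m\<close> and mean \<open>b\<close>, namely the Stieltjes measure of its right derivative
  (\<open>convex_is_put\<close>). So everything about the shadow measure can be read off from asymptotics. The
  infimum of \<open>D\<close> is \<open>- p\<close>, and a convex function that is bounded near \<open>-\<infinity>\<close> tends to its infimum
  there; hence \<open>c\<close> tends to \<open>- p\<close> at \<open>-\<infinity>\<close>, and \<open>put \<nu> - c - p\<close> vanishes there. Put-call parity
  turns \<open>D\<close> into an affine function plus \<open>call \<nu> - call \<mu>\<close>, and the reflected argument gives the
  asymptote at \<open>\<infinity>\<close>, in which \<open>q\<close> replaces \<open>p\<close>. This gives the measure \<open>S\<close> with its mass and mean.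

  The function \<open>c + p\<close> is a put function by the same criterion, say of \<open>T\<close>. Since
  \<open>put S + put T = put \<nu>\<close> and put functions determine measures additively
  (\<open>emeasure_add_eq_of_put\<close>), we get \<open>S + T = \<nu>\<close> and therefore \<open>S \<le> \<nu>\<close>. Uniqueness is the case
  \<open>T = 0\<close> of the same lemma. Finally, the second distributional derivative of a put function is its
  measure, because \<open>\<lambda>k. max (k - x) 0\<close> is a fundamental solution of the second derivative.
\<close>

section \<open>Convex functions on the line\<close>

text \<open>
  The form of convexity used throughout: it speaks of affine upper bounds at two points, without
  convex combinations, so that suprema, gluing and restriction to a subinterval become immediate.
\<close>

lemma convex_on_UNIV_iff_below_affine:
  fixes f :: "real \<Rightarrow> real"
  shows "convex_on UNIV f \<longleftrightarrow>
    (\<forall>x z y p q. x \<le> z \<longrightarrow> z \<le> y \<longrightarrow> f x \<le> p * x + q \<longrightarrow> f y \<le> p * y + q \<longrightarrow> f z \<le> p * z + q)"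
    (is "_ \<longleftrightarrow> ?below")
proof
  assume cvx: "convex_on UNIV f"
  have "f z \<le> p * z + q"
    if "x \<le> z" "z \<le> y" and bnd: "f x \<le> p * x + q" "f y \<le> p * y + q" for x y z p q
  proof (cases "x = y")
    case True
    with that show ?thesis by auto
  next
    case False
    define t where "t = (z - x) / (y - x)"
    have t: "0 \<le> t" "t \<le> 1"
      using False that by (auto simp: t_def field_simps)
    have "t * (y - x) = z - x"
      using False by (simp add: t_def)
    then have z: "z = (1 - t) * x + t * y"
      by (simp add: algebra_simps)
    have "f z \<le> (1 - t) * f x + t * f y"
      unfolding z using convex_onD[OF cvx, of t x y] t by simp
    also have "\<dots> \<le> (1 - t) * (p * x + q) + t * (p * y + q)"
      using t bnd by (intro add_mono mult_left_mono) auto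
    also have "\<dots> = p * z + q"
      unfolding z by (simp add: algebra_simps)
    finally show ?thesis .
  qed
  then show ?below by blast
next
  assume below: ?below
  show "convex_on UNIV f"
  proof (rule convex_on_linorderI)
    fix t x y :: real
    assume t: "0 < t" "t < 1" and xy: "x < y"
    define p where "p = (f y - f x) / (y - x)"
    define q where "q = f x - p * x"
    have py: "p * (y - x) = f y - f x"
      using xy by (simp add: p_def)
    have ends: "f x = p * x + q" "f y = p * y + q"
      using py by (auto simp: q_def algebra_simps)
    have "0 \<le> t * (y - x)" "0 \<le> (1 - t) * (y - x)"
      using t xy by auto
    then have "f ((1 - t) * x + t * y) \<le> p * ((1 - t) * x + t * y) + q"
      using ends by (intro below[rule_format, of x "(1 - t) * x + t * y" y]) (auto simp: algebra_simps)
    also have "\<dots> = (1 - t) * f x + t * f y"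
      unfolding ends by (simp add: algebra_simps)
    finally show "f ((1 - t) *\<^sub>R x + t *\<^sub>R y) \<le> (1 - t) * f x + t * f y"
      by simp
  qed simp
qed

lemma convex_on_below_affine:
  fixes f :: "real \<Rightarrow> real"
  assumes "convex_on UNIV f" "x \<le> z" "z \<le> y" "f x \<le> p * x + q" "f y \<le> p * y + q"
  shows "f z \<le> p * z + q"
  using assms(2-) convex_on_UNIV_iff_below_affine[THEN iffD1, OF assms(1), rule_format, of x z y p q]
  by simp

lemma convex_on_UNIV_affine: "convex_on UNIV (\<lambda>x::real. p * x + q :: real)"
proof (subst convex_on_UNIV_iff_below_affine, intro allI impI)
  fix x z y p' q' :: real
  assume xz: "x \<le> z" and zy: "z \<le> y"
    and x: "p * x + q \<le> p' * x + q'" and y: "p * y + q \<le> p' * y + q'"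
  show "p * z + q \<le> p' * z + q'"
  proof (cases "p \<le> p'")
    case True
    then have "(p' - p) * x \<le> (p' - p) * z"
      using xz by (intro mult_left_mono) auto
    with x show ?thesis by (simp add: algebra_simps)
  next
    case False
    then have "(p - p') * z \<le> (p - p') * y"
      using zy by (intro mult_left_mono) auto
    with y show ?thesis by (simp add: algebra_simps)
  qed
qed

lemma convex_on_add_affine:
  fixes f :: "real \<Rightarrow> real"
  assumes "convex_on UNIV f"
  shows "convex_on UNIV (\<lambda>x. f x + (p * x + q))"
  using convex_on_add[OF assms convex_on_UNIV_affine] by simp

lemma convex_on_reflect:
  fixes f :: "real \<Rightarrow> real"
  assumes "convex_on UNIV f"
  shows "convex_on UNIV (\<lambda>x. f (- x))"
  unfolding convex_on_UNIV_iff_below_affine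
proof (intro allI impI)
  fix x z y p q :: real
  assume le: "x \<le> z" "z \<le> y" and ends: "f (- x) \<le> p * x + q" "f (- y) \<le> p * y + q"
  have "f (- z) \<le> (- p) * (- z) + q"
    using le ends by (intro convex_on_below_affine[OF assms, of "- y" "- z" "- x"]) auto
  then show "f (- z) \<le> p * z + q"
    by simp
qed

text \<open>
  The pointwise supremum of all convex minorants is convex. One minorant \<open>g0\<close> must be given: without
  it the supremum would range over the empty set.
\<close>

lemma
  fixes f g0 :: "real \<Rightarrow> real"
  assumes g0: "convex_on UNIV g0" "g0 \<le> f"
  shows convex_on_convex_minorant: "convex_on UNIV (convex_minorant f)"
    and convex_minorant_le: "convex_minorant f \<le> f"
    and convex_minorant_greatest:
      "\<And>g. convex_on UNIV g \<Longrightarrow> g \<le> f \<Longrightarrow> g \<le> convex_minorant f"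
proof -
  define C where "C = {g. convex_on UNIV g \<and> g \<le> f}"
  define s where "s x = (SUP g\<in>C. g x)" for x
  have ne: "C \<noteq> {}"
    using g0 by (auto simp: C_def)
  have bdd: "bdd_above ((\<lambda>g. g x) ` C)" for x
    by (rule bdd_aboveI[of _ "f x"]) (auto simp: C_def le_fun_def)
  have upper: "g x \<le> s x" if "g \<in> C" for g x
    unfolding s_def using bdd that by (intro cSUP_upper) auto
  have "convex_on UNIV s"
    unfolding convex_on_UNIV_iff_below_affine
  proof (intro allI impI)
    fix x z y p q :: real
    assume xzy: "x \<le> z" "z \<le> y" and s: "s x \<le> p * x + q" "s y \<le> p * y + q"
    have "g z \<le> p * z + q" if "g \<in> C" for g
      using convex_on_below_affine[of g x z y p q] xzy s upper[OF that, of x] upper[OF that, of y] that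
      by (auto simp: C_def)
    then show "s z \<le> p * z + q"
      unfolding s_def using ne by (intro cSUP_least) auto
  qed
  moreover have "s \<le> f"
    unfolding s_def le_fun_def using ne by (auto intro!: cSUP_least simp: C_def le_fun_def)
  moreover have "g \<le> s" if "convex_on UNIV g" "g \<le> f" for g
    using upper[of g] that by (auto simp: le_fun_def C_def)
  moreover from calculation have "convex_minorant f = s"
    unfolding convex_minorant_def by (intro Greatest_equality) auto
  ultimately show "convex_on UNIV (convex_minorant f)" "convex_minorant f \<le> f"
    "\<And>g. convex_on UNIV g \<Longrightarrow> g \<le> f \<Longrightarrow> g \<le> convex_minorant f"
    by auto
qed

text \<open>
  Raising \<open>c\<close> to \<open>u\<close> inside \<open>[a, b]\<close> keeps it convex if \<open>u\<close> does not exceed \<open>c\<close> at the ends: a line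
  above the glued function at \<open>x\<close> and \<open>y\<close> is above \<open>c\<close> between them, hence above \<open>u\<close> at those ends of
  \<open>[a, b]\<close> that lie between \<open>x\<close> and \<open>y\<close>, and convexity of \<open>u\<close> does the rest.
\<close>

lemma convex_on_glue_max:
  fixes c u :: "real \<Rightarrow> real"
  assumes c: "convex_on UNIV c" and u: "convex_on UNIV u" and ends: "u a \<le> c a" "u b \<le> c b"
  shows "convex_on UNIV (\<lambda>x. if a \<le> x \<and> x \<le> b then max (c x) (u x) else c x)"
    (is "convex_on UNIV ?g")
  unfolding convex_on_UNIV_iff_below_affine
proof (intro allI impI)
  fix x z y p q :: real
  assume xz: "x \<le> z" and zy: "z \<le> y" and gx: "?g x \<le> p * x + q" and gy: "?g y \<le> p * y + q"
  have c_le: "c t \<le> p * t + q" if "x \<le> t" "t \<le> y" for t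
    using convex_on_below_affine[OF c that, of p q] gx gy by (auto split: if_splits)
  show "?g z \<le> p * z + q"
  proof (cases "a \<le> z \<and> z \<le> b")
    case True
    define x' y' where "x' = max x a" and "y' = min y b"
    have "u x' \<le> p * x' + q"
      using gx ends c_le[of a] True xz zy by (auto simp: x'_def max_def split: if_splits)
    moreover have "u y' \<le> p * y' + q"
      using gy ends c_le[of b] True xz zy by (auto simp: y'_def min_def split: if_splits)
    ultimately have "u z \<le> p * z + q"
      using True xz zy by (intro convex_on_below_affine[OF u, of x' z y']) (auto simp: x'_def y'_def)
    then show ?thesis
      using c_le[OF xz zy] by simp
  qed (use c_le[OF xz zy] in auto)
qed

text \<open>
  Let \<open>c\<close> be the minorant and \<open>l\<close> an affine function above \<open>F - c\<close> at \<open>a\<close> and \<open>b\<close>. Glue \<open>F - l\<close> into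
  \<open>c\<close> on \<open>[a, b]\<close>. The result is convex, and it is still a minorant of \<open>F - G\<close> because
  \<open>G \<le> F - c\<close> forces \<open>G \<le> l\<close> on \<open>[a, b]\<close>. By maximality of \<open>c\<close> it is at most \<open>c\<close>, which means
  \<open>F - c \<le> l\<close> on \<open>[a, b]\<close>.
\<close>

lemma convex_on_minus_convex_minorant:
  fixes F G :: "real \<Rightarrow> real"
  assumes F: "convex_on UNIV F" and G: "convex_on UNIV G"
    and g0: "convex_on UNIV g0" "g0 \<le> (\<lambda>x. F x - G x)"
  shows "convex_on UNIV (\<lambda>x. F x - convex_minorant (\<lambda>x. F x - G x) x)"
proof -
  define c where "c = convex_minorant (\<lambda>x. F x - G x)"
  have c: "convex_on UNIV c"
    unfolding c_def by (rule convex_on_convex_minorant[OF g0])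
  have c_le: "c x \<le> F x - G x" for x
    using convex_minorant_le[OF g0] by (simp add: c_def le_fun_def)
  show ?thesis
    unfolding c_def[symmetric] convex_on_UNIV_iff_below_affine
  proof (intro allI impI)
    fix a z b p q :: real
    assume az: "a \<le> z" and zb: "z \<le> b"
      and hx: "F a - c a \<le> p * a + q" and hy: "F b - c b \<le> p * b + q"
    define u where "u x = F x + ((- p) * x + (- q))" for x
    define g where "g x = (if a \<le> x \<and> x \<le> b then max (c x) (u x) else c x)" for x
    have "convex_on UNIV u"
      unfolding u_def by (rule convex_on_add_affine[OF F])
    moreover have "u a \<le> c a" "u b \<le> c b"
      using hx hy by (auto simp: u_def)
    ultimately have "convex_on UNIV g"
      unfolding g_def by (intro convex_on_glue_max[OF c])
    moreover have "g x \<le> F x - G x" for x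
    proof -
      have "G x \<le> p * x + q" if "a \<le> x" "x \<le> b"
        using c_le[of a] c_le[of b] hx hy by (intro convex_on_below_affine[OF G that]) auto
      then show ?thesis
        using c_le[of x] by (auto simp: g_def u_def)
    qed
    ultimately have "g \<le> c"
      unfolding c_def by (intro convex_minorant_greatest[OF g0]) (auto simp: le_fun_def)
    then have "g z \<le> c z"
      by (simp add: le_fun_def)
    then show "F z - c z \<le> p * z + q"
      using az zb by (simp add: g_def u_def)
  qed
qed

text \<open>
  A convex function bounded above near \<open>-\<infinity>\<close> is monotone, since a decreasing chord extended to the
  left would exceed any bound. So its limit is its infimum, for which \<open>low\<close> and \<open>inf\<close> say that it is \<open>m\<close>.
\<close>

lemma convex_tendsto_Inf_at_bot:
  fixes f :: "real \<Rightarrow> real"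
  assumes f: "convex_on UNIV f" and up: "\<And>x. x \<le> 0 \<Longrightarrow> f x \<le> B"
    and low: "\<And>x. m \<le> f x" and inf: "\<And>e. e > 0 \<Longrightarrow> \<exists>x. f x < m + e"
  shows "(f \<longlongrightarrow> m) at_bot"
proof -
  have mono: "f x \<le> f y" if xy: "x \<le> y" for x y
  proof (rule ccontr)
    assume "\<not> f x \<le> f y"
    then have xy: "x < y" and gt: "f y < f x"
      using that by (cases "x = y"; auto)+
    define p where "p = (f x - f y) / (x - y)"
    define q where "q = f x - p * x"
    have p: "p < 0"
      unfolding p_def using xy gt by (intro divide_pos_neg) auto
    have "p * (x - y) = f x - f y"
      using xy by (simp add: p_def)
    then have fy: "f y = p * y + q"
      by (simp add: q_def algebra_simps)
    \<comment> \<open>Since \<open>p < 0\<close>, the chord exceeds the bound \<open>B\<close> to the left of \<open>(B - q) / p\<close>.\<close>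
    define w where "w = min (min 0 (x - 1)) ((B - q) / p - 1)"
    have w: "w \<le> 0" "w \<le> x - 1" "w < (B - q) / p"
      by (auto simp: w_def)
    then have "p * w + q > B"
      using p by (simp add: field_simps)
    then have wlt: "f w < p * w + q"
      using up[of w] w by simp
    \<comment> \<open>Tilt the chord about \<open>y\<close> until it meets the graph at \<open>w\<close>. By convexity the tilted line is
      above the graph at \<open>x\<close>, although it lies strictly below the chord there.\<close>
    define p' where "p' = p + (p * w + q - f w) / (y - w)"
    have yw: "y - w > 0" using w xy by simp
    have pp': "p' > p"
      using wlt yw by (simp add: p'_def)
    have "(p' - p) * (y - w) = p * w + q - f w"
      using yw by (simp add: p'_def)
    then have w': "p' * w + (q + (p - p') * y) = f w"
      by (simp add: algebra_simps)
    have "f x \<le> p' * x + (q + (p - p') * y)"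
      using w xy fy w' by (intro convex_on_below_affine[OF f, of w x y]) (auto simp: algebra_simps)
    also have "\<dots> = p * x + q + (p' - p) * (x - y)"
      by (simp add: algebra_simps)
    also have "\<dots> < p * x + q"
      using pp' xy by (simp add: mult_pos_neg)
    finally show False
      by (simp add: q_def)
  qed
  show ?thesis
  proof (rule order_tendstoI)
    fix a assume "a < m"
    then show "\<forall>\<^sub>F x in at_bot. a < f x"
      using low by (intro always_eventually allI) (rule less_le_trans)
  next
    fix a assume "m < a"
    then obtain x where "f x < a"
      using inf[of "a - m"] by auto
    then have "f y < a" if "y \<le> x" for y
      using mono[OF that] by simp
    then show "\<forall>\<^sub>F x in at_bot. f x < a"
      by (auto simp: eventually_at_bot_linorder)
  qed
qed

section \<open>Right derivatives of convex functions\<close>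

text \<open>
  For convex functions the slopes to the right of a point decrease towards it, so the limit is an
  infimum.
\<close>

definition right_deriv :: "(real \<Rightarrow> real) \<Rightarrow> real \<Rightarrow> real" where
  "right_deriv f x = (INF y\<in>{x<..}. (f y - f x) / (y - x))"

lemma convex_on_UNIV_slopes:
  fixes f :: "real \<Rightarrow> real"
  assumes "convex_on UNIV f" "x < y" "y < z"
  shows "(f y - f x) / (y - x) \<le> (f z - f y) / (z - y)"
proof -
  have "(f x - f y) / (x - y) \<le> (f y - f z) / (y - z)"
    using convex_on_slope_le[OF assms(1) UNIV_I UNIV_I assms(2,3)] by linarith
  then show ?thesis
    by (metis minus_diff_eq minus_divide_divide)
qed

lemma
  fixes f :: "real \<Rightarrow> real"
  assumes f: "convex_on UNIV f" and xy: "x < y"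
  shows right_deriv_lower: "right_deriv f x * (y - x) \<le> f y - f x"
    and right_deriv_upper: "f y - f x \<le> right_deriv f y * (y - x)"
proof -
  have "right_deriv f x \<le> (f y - f x) / (y - x)"
    unfolding right_deriv_def
  proof (rule cINF_lower)
    show "bdd_below ((\<lambda>y. (f y - f x) / (y - x)) ` {x<..})"
      using convex_on_UNIV_slopes[OF f, of "x - 1" x]
      by (intro bdd_belowI[of _ "(f x - f (x - 1)) / (x - (x - 1))"]) auto
  qed (use xy in auto)
  then show "right_deriv f x * (y - x) \<le> f y - f x"
    using xy by (simp add: pos_le_divide_eq)
  have "(f y - f x) / (y - x) \<le> right_deriv f y"
    unfolding right_deriv_def using convex_on_UNIV_slopes[OF f xy] by (intro cINF_greatest) auto
  then show "f y - f x \<le> right_deriv f y * (y - x)"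
    using xy by (simp add: pos_divide_le_eq)
qed

lemma right_deriv_mono:
  fixes f :: "real \<Rightarrow> real"
  assumes f: "convex_on UNIV f" and xy: "x \<le> y"
  shows "right_deriv f x \<le> right_deriv f y"
proof (cases "x = y")
  case False
  then have "x < y"
    using xy by simp
  with right_deriv_lower[OF f this] right_deriv_upper[OF f this] show ?thesis
    by (meson diff_gt_0_iff_gt mult_le_cancel_right_pos order_trans)
qed simp

lemma continuous_at_right_right_deriv:
  fixes f :: "real \<Rightarrow> real"
  assumes f: "convex_on UNIV f"
  shows "continuous (at_right x) (right_deriv f)"
  unfolding continuous_within
proof (rule order_tendstoI)
  fix a assume "a < right_deriv f x"
  then have "a < right_deriv f y" if "x < y" for y
    using right_deriv_mono[OF f, of x y] that by simp
  then show "\<forall>\<^sub>F y in at_right x. a < right_deriv f y"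
    by (auto simp: eventually_at_filter)
next
  fix a assume "right_deriv f x < a"
  then obtain t where t: "x < t" "(f t - f x) / (t - x) < a"
    unfolding right_deriv_def by (subst (asm) cInf_less_iff)
      (use convex_on_UNIV_slopes[OF f, of "x - 1" x] in
        \<open>auto intro!: bdd_belowI[of _ "(f x - f (x - 1)) / (x - (x - 1))"]\<close>)
  have cont: "continuous_on UNIV f"
    using f by (intro convex_on_continuous) auto
  then have "(f \<longlongrightarrow> f x) (at x)"
    by (simp add: continuous_on_eq_continuous_at isCont_def)
  then have "(f \<longlongrightarrow> f x) (at_right x)"
    by (rule tendsto_mono[rotated]) (simp add: at_le)
  then have "((\<lambda>y. (f t - f y) / (t - y)) \<longlongrightarrow> (f t - f x) / (t - x)) (at_right x)"
    using t by (intro tendsto_intros) auto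
  then have "\<forall>\<^sub>F y in at_right x. (f t - f y) / (t - y) < a"
    by (rule order_tendstoD(2)) (rule t(2))
  moreover have "\<forall>\<^sub>F y in at_right x. y < t"
    using t(1) by (rule eventually_at_right_real[THEN eventually_mono]) auto
  ultimately show "\<forall>\<^sub>F y in at_right x. right_deriv f y < a"
  proof eventually_elim
    case (elim y)
    have "right_deriv f y \<le> (f t - f y) / (t - y)"
      using right_deriv_lower[OF f \<open>y < t\<close>] \<open>y < t\<close> by (simp add: pos_le_divide_eq)
    then show ?case
      using elim by simp
  qed
qed

text \<open>
  The right derivative lies between the increments over the unit intervals on both sides of the
  point; these tend to \<open>0\<close> here and to the asymptotic slope in the next lemma.
\<close>

lemma right_deriv_tendsto_at_bot:
  fixes f :: "real \<Rightarrow> real"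
  assumes f: "convex_on UNIV f" and lim: "(f \<longlongrightarrow> l) at_bot"
  shows "(right_deriv f \<longlongrightarrow> 0) at_bot"
proof (rule tendsto_sandwich)
  have shift: "filterlim (\<lambda>x::real. x + s) at_bot at_bot" for s
    unfolding filterlim_at_bot eventually_at_bot_linorder
    by (metis add.commute le_diff_eq)
  have s: "((\<lambda>x. f (x + s)) \<longlongrightarrow> l) at_bot" for s
    by (rule filterlim_compose[OF lim shift])
  show "((\<lambda>x. f x - f (x + (- 1))) \<longlongrightarrow> 0) at_bot"
    using tendsto_diff[OF lim s[of "- 1"]] by simp
  show "((\<lambda>x. f (x + 1) - f x) \<longlongrightarrow> 0) at_bot"
    using tendsto_diff[OF s[of 1] lim] by simp
qed (use right_deriv_lower[OF f, of x "x + 1" for x] right_deriv_upper[OF f, of "x - 1" x for x] in auto)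

lemma right_deriv_tendsto_at_top:
  fixes f :: "real \<Rightarrow> real"
  assumes f: "convex_on UNIV f" and lim: "((\<lambda>x. f x - m * x) \<longlongrightarrow> l) at_top"
  shows "(right_deriv f \<longlongrightarrow> m) at_top"
proof (rule tendsto_sandwich)
  have shift: "filterlim (\<lambda>x::real. x + s) at_top at_top" for s
    unfolding filterlim_at_top eventually_at_top_linorder
    by (metis add.commute diff_le_eq)
  have s: "((\<lambda>x. f (x + s) - m * (x + s)) \<longlongrightarrow> l) at_top" for s
    by (rule filterlim_compose[OF lim shift])
  have "((\<lambda>x. (f x - m * x) - (f (x + (- 1)) - m * (x + (- 1))) + m) \<longlongrightarrow> l - l + m) at_top"
    by (intro tendsto_intros lim s)
  then show "((\<lambda>x. f x - f (x + (- 1))) \<longlongrightarrow> m) at_top"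
    by (simp add: algebra_simps)
  have "((\<lambda>x. (f (x + 1) - m * (x + 1)) - (f x - m * x) + m) \<longlongrightarrow> l - l + m) at_top"
    by (intro tendsto_intros lim s)
  then show "((\<lambda>x. f (x + 1) - f x) \<longlongrightarrow> m) at_top"
    by (simp add: algebra_simps)
qed (use right_deriv_lower[OF f, of x "x + 1" for x] right_deriv_upper[OF f, of "x - 1" x for x] in auto)

text \<open>
  A substitute for the fundamental theorem of calculus. On an interval the increments of \<open>f\<close> and \<open>g\<close>
  differ by at most its length times the increment of \<open>r\<close>. Over \<open>n\<close> equal pieces these bounds
  telescope to \<open>(r y - r x) * (y - x) / n\<close>, for every \<open>n\<close>.
\<close>

lemma increments_eq_of_mono_bounds:
  fixes f g r :: "real \<Rightarrow> real"
  assumes f: "\<And>x y. x < y \<Longrightarrow> r x * (y - x) \<le> f y - f x" "\<And>x y. x < y \<Longrightarrow> f y - f x \<le> r y * (y - x)"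
    and g: "\<And>x y. x < y \<Longrightarrow> r x * (y - x) \<le> g y - g x" "\<And>x y. x < y \<Longrightarrow> g y - g x \<le> r y * (y - x)"
  shows "f y - f x = g y - g x"
proof -
  have ord: "f y - f x = g y - g x" if xy: "x < y" for x y
  proof -
    define u where "u t = f t - g t" for t
    have u: "\<bar>u t - u s\<bar> \<le> (r t - r s) * (t - s)" if "s < t" for s t
      using f[OF that] g[OF that] by (auto simp: u_def abs_le_iff algebra_simps)
    have bound: "\<bar>u y - u x\<bar> \<le> (r y - r x) * (y - x) * inverse (real (Suc n))" for n
    proof -
      define d where "d = (y - x) / real (Suc n)"
      define p where "p i = x + real i * d" for i
      have d: "d > 0"
        using xy by (simp add: d_def)
      have p: "p (Suc i) - p i = d" for i
        by (simp add: p_def algebra_simps)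
      have p0: "p 0 = x" and pn: "p (Suc n) = y"
        by (auto simp: p_def d_def simp del: of_nat_Suc)
      have "\<bar>u y - u x\<bar> = \<bar>\<Sum>i<Suc n. u (p (Suc i)) - u (p i)\<bar>"
        unfolding sum_lessThan_telescope[of "\<lambda>i. u (p i)"] p0 pn ..
      also have "\<dots> \<le> (\<Sum>i<Suc n. \<bar>u (p (Suc i)) - u (p i)\<bar>)"
        by (rule sum_abs)
      also have "\<dots> \<le> (\<Sum>i<Suc n. (r (p (Suc i)) - r (p i)) * d)"
        using u[of "p i" "p (Suc i)" for i] p d
        by (intro sum_mono) (metis diff_gt_0_iff_gt)
      also have "\<dots> = (r y - r x) * d"
        unfolding sum_distrib_right[symmetric] sum_lessThan_telescope[of "\<lambda>i. r (p i)"] p0 pn ..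
      finally show ?thesis
        by (simp add: d_def field_simps)
    qed
    have "(\<lambda>n. (r y - r x) * (y - x) * inverse (real (Suc n))) \<longlonglongrightarrow> (r y - r x) * (y - x) * 0"
      by (intro tendsto_mult tendsto_const LIMSEQ_inverse_real_of_nat)
    then have "\<bar>u y - u x\<bar> \<le> 0"
      using bound by (intro LIMSEQ_le_const) auto
    then show ?thesis
      by (simp add: u_def)
  qed
  show ?thesis
    using ord[of x y] ord[of y x] by (cases x y rule: linorder_cases) auto
qed

section \<open>Put and call functions\<close>

lemma finite_borel_measure_of_moment:
  assumes "\<eta> \<in> \<M>"
  shows "finite_borel_measure \<eta>"
  using assms by (simp add: finite_moment_measures_def finite_borel_measure_def finite_borel_measure_axioms_def)

lemma integrable_of_moment:
  assumes "\<eta> \<in> \<M>"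
  shows "integrable \<eta> (\<lambda>x. x)" "integrable \<eta> (\<lambda>x. max (k - x) 0)" "integrable \<eta> (\<lambda>x. max (x - k) 0)"
proof -
  have [measurable_cong]: "sets \<eta> = sets borel"
    using assms by (simp add: finite_moment_measures_def)
  interpret finite_borel_measure \<eta>
    by (rule finite_borel_measure_of_moment[OF assms])
  show 1: "integrable \<eta> (\<lambda>x. x)"
    using assms by (intro integrableI_bounded) (auto simp: finite_moment_measures_def)
  have 2: "integrable \<eta> (\<lambda>x. \<bar>x\<bar> + \<bar>k\<bar>)"
    using 1 by auto
  show "integrable \<eta> (\<lambda>x. max (k - x) 0)" "integrable \<eta> (\<lambda>x. max (x - k) 0)"
    by (rule Bochner_Integration.integrable_bound[OF 2]; force)+
qed

text \<open>
  Put-call parity: \<open>max (k - x) 0 - max (x - k) 0 = k - x\<close>.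
\<close>

lemma put_minus_call:
  assumes "\<eta> \<in> \<M>"
  shows "put \<eta> k = measure \<eta> UNIV * k - mean \<eta> + call \<eta> k"
proof -
  interpret finite_borel_measure \<eta>
    by (rule finite_borel_measure_of_moment[OF assms])
  have "put \<eta> k - call \<eta> k = (\<integral>x. max (k - x) 0 - max (x - k) 0 \<partial>\<eta>)"
    unfolding put_def call_def using integrable_of_moment[OF assms] by simp
  also have "\<dots> = (\<integral>x. k - x \<partial>\<eta>)"
    by (intro Bochner_Integration.integral_cong) auto
  also have "\<dots> = measure \<eta> UNIV * k - mean \<eta>"
    using integrable_of_moment[OF assms] by (simp add: mean_def borel_UNIV)
  finally show ?thesis
    by simp
qed

lemma put_nonneg: "0 \<le> put \<eta> k"
  by (simp add: put_def)

lemma call_nonneg: "0 \<le> call \<eta> k"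
  by (simp add: call_def)

lemma put_mono:
  assumes "\<eta> \<in> \<M>" "k \<le> l"
  shows "put \<eta> k \<le> put \<eta> l"
  unfolding put_def using assms(2) by (intro integral_mono integrable_of_moment[OF assms(1)]) auto

lemma call_antimono:
  assumes "\<eta> \<in> \<M>" "k \<le> l"
  shows "call \<eta> l \<le> call \<eta> k"
  unfolding call_def using assms(2) by (intro integral_mono integrable_of_moment[OF assms(1)]) auto

lemma call_tendsto_at_top:
  assumes "\<eta> \<in> \<M>"
  shows "(call \<eta> \<longlongrightarrow> 0) at_top"
proof -
  have [measurable_cong]: "sets \<eta> = sets borel"
    using assms by (simp add: finite_moment_measures_def)
  have "((\<lambda>k. \<integral>x. max (x - k) 0 \<partial>\<eta>) \<longlongrightarrow> (\<integral>x. 0 \<partial>\<eta>)) at_top"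
  proof (rule integral_dominated_convergence_at_top)
    show "integrable \<eta> (\<lambda>x. max (x - 0) 0)"
      by (rule integrable_of_moment[OF assms])
    have "((\<lambda>k. max (x - k) 0) \<longlongrightarrow> 0) at_top" for x :: real
      by (rule tendsto_eventually) (auto intro: eventually_mono[OF eventually_ge_at_top[of x]])
    then show "AE x in \<eta>. ((\<lambda>k. max (x - k) 0) \<longlongrightarrow> 0) at_top"
      by simp
    show "\<forall>\<^sub>F k in at_top. AE x in \<eta>. norm (max (x - k) 0) \<le> max (x - 0) 0"
      by (auto intro: eventually_mono[OF eventually_ge_at_top[of 0]])
  qed auto
  then show ?thesis
    by (simp add: call_def[abs_def])
qed

lemma put_tendsto_at_bot:
  assumes "\<eta> \<in> \<M>"
  shows "(put \<eta> \<longlongrightarrow> 0) at_bot"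
proof -
  have [measurable_cong]: "sets \<eta> = sets borel"
    using assms by (simp add: finite_moment_measures_def)
  have "((\<lambda>k. \<integral>x. max (- k - x) 0 \<partial>\<eta>) \<longlongrightarrow> (\<integral>x. 0 \<partial>\<eta>)) at_top"
  proof (rule integral_dominated_convergence_at_top)
    show "integrable \<eta> (\<lambda>x. max (0 - x) 0)"
      by (rule integrable_of_moment[OF assms])
    have "((\<lambda>k. max (- k - x) 0) \<longlongrightarrow> 0) at_top" for x :: real
      by (rule tendsto_eventually) (auto intro: eventually_mono[OF eventually_ge_at_top[of "- x"]])
    then show "AE x in \<eta>. ((\<lambda>k. max (- k - x) 0) \<longlongrightarrow> 0) at_top"
      by simp
    show "\<forall>\<^sub>F k in at_top. AE x in \<eta>. norm (max (- k - x) 0) \<le> max (0 - x) 0"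
      by (auto intro: eventually_mono[OF eventually_ge_at_top[of 0]])
  qed auto
  then show ?thesis
    by (simp add: put_def[abs_def] filterlim_at_bot_mirror)
qed

lemma convex_on_put:
  assumes "\<eta> \<in> \<M>"
  shows "convex_on UNIV (put \<eta>)"
proof (rule convex_on_linorderI)
  fix t x y :: real
  assume t: "0 < t" "t < 1"
  have "put \<eta> ((1 - t) * x + t * y) \<le> (\<integral>z. (1 - t) * max (x - z) 0 + t * max (y - z) 0 \<partial>\<eta>)"
    unfolding put_def
  proof (intro integral_mono)
    fix z
    have "(1 - t) * x + t * y - z = (1 - t) * (x - z) + t * (y - z)"
      by (simp add: algebra_simps)
    also have "\<dots> \<le> (1 - t) * max (x - z) 0 + t * max (y - z) 0"
      using t by (intro add_mono mult_left_mono) auto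
    finally show "max ((1 - t) * x + t * y - z) 0 \<le> (1 - t) * max (x - z) 0 + t * max (y - z) 0"
      using t by simp
  qed (use integrable_of_moment[OF assms] in simp_all)
  also have "\<dots> = (1 - t) * put \<eta> x + t * put \<eta> y"
    unfolding put_def using integrable_of_moment[OF assms] by simp
  finally show "put \<eta> ((1 - t) *\<^sub>R x + t *\<^sub>R y) \<le> (1 - t) * put \<eta> x + t * put \<eta> y"
    by simp
qed simp

text \<open>
  For \<open>x < y\<close> the integrand below lies between \<open>y - x\<close> times the indicators of \<open>{..x}\<close> and \<open>{..y}\<close>.
  It is bounded, so the increments make sense before a first moment is known to exist.
\<close>

context finite_borel_measure
begin

lemma integrable_put_increment: "integrable M (\<lambda>t. max (y - t) 0 - max (x - t) 0)"
proof -
  have [measurable_cong]: "sets M = sets borel" by (rule M_is_borel)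
  show ?thesis
    by (rule integrable_const_bound[of _ "\<bar>y - x\<bar>"]) auto
qed

lemma put_increment_bounds:
  assumes "x < y"
  shows "cdf M x * (y - x) \<le> (\<integral>t. max (y - t) 0 - max (x - t) 0 \<partial>M)"
    and "(\<integral>t. max (y - t) 0 - max (x - t) 0 \<partial>M) \<le> cdf M y * (y - x)"
proof -
  have meas: "{..z} \<in> sets M" for z :: real
    by (simp add: M_is_borel)
  have ind: "integrable M (\<lambda>t. indicator {..z} t * (y - x))" for z
    using meas[of z] by (simp add: emeasure_eq_measure)
  have int_ind: "(\<integral>t. indicator {..z} t * (y - x) \<partial>M) = cdf M z * (y - x)" for z
    using meas[of z] by (simp add: cdf_def borel_UNIV)
  show "cdf M x * (y - x) \<le> (\<integral>t. max (y - t) 0 - max (x - t) 0 \<partial>M)"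
    unfolding int_ind[symmetric] using assms
    by (intro integral_mono ind integrable_put_increment) (auto split: split_indicator)
  show "(\<integral>t. max (y - t) 0 - max (x - t) 0 \<partial>M) \<le> cdf M y * (y - x)"
    unfolding int_ind[symmetric] using assms
    by (intro integral_mono ind integrable_put_increment) (auto split: split_indicator)
qed

end

lemma put_increment_cdf:
  assumes "\<eta> \<in> \<M>" "x < y"
  shows "cdf \<eta> x * (y - x) \<le> put \<eta> y - put \<eta> x"
    and "put \<eta> y - put \<eta> x \<le> cdf \<eta> y * (y - x)"
proof -
  interpret finite_borel_measure \<eta>
    by (rule finite_borel_measure_of_moment[OF assms(1)])
  have "put \<eta> y - put \<eta> x = (\<integral>t. max (y - t) 0 - max (x - t) 0 \<partial>\<eta>)"
    unfolding put_def using integrable_of_moment[OF assms(1)] by simp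
  then show "cdf \<eta> x * (y - x) \<le> put \<eta> y - put \<eta> x" "put \<eta> y - put \<eta> x \<le> cdf \<eta> y * (y - x)"
    using put_increment_bounds[OF assms(2)] by simp_all
qed

text \<open>
  The slopes of a put function lie between the values of the distribution function at the ends. Letting
  the right end tend to the left one, right continuity makes the distribution functions add up as the
  put functions do, and this carries over from half-lines to all Borel sets.
\<close>

lemma emeasure_add_eq_of_put:
  assumes S: "\<sigma> \<in> \<M>" and T: "\<tau> \<in> \<M>" and N: "\<eta> \<in> \<M>"
    and put: "\<And>k. put \<sigma> k + put \<tau> k = put \<eta> k" and A: "A \<in> sets borel"
  shows "emeasure \<sigma> A + emeasure \<tau> A = emeasure \<eta> A"
proof -
  interpret S: finite_borel_measure \<sigma> by (rule finite_borel_measure_of_moment[OF S])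
  interpret T: finite_borel_measure \<tau> by (rule finite_borel_measure_of_moment[OF T])
  interpret N: finite_borel_measure \<eta> by (rule finite_borel_measure_of_moment[OF N])
  have right: "(cdf M \<longlongrightarrow> cdf M x) (at_right x)" if "finite_borel_measure M" for M x
    using finite_borel_measure.cdf_is_right_cont[OF that] by (simp add: continuous_within)
  have cdf: "cdf \<sigma> x + cdf \<tau> x = cdf \<eta> x" for x
  proof (rule antisym)
    have "cdf \<sigma> x + cdf \<tau> x \<le> cdf \<eta> y" if "x < y" for y
    proof -
      have "(cdf \<sigma> x + cdf \<tau> x) * (y - x) \<le> cdf \<eta> y * (y - x)"
        using put_increment_cdf(1)[OF S that] put_increment_cdf(1)[OF T that]
          put_increment_cdf(2)[OF N that] put[of x] put[of y] by (simp add: algebra_simps)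
      then show ?thesis
        using that by simp
    qed
    then show "cdf \<sigma> x + cdf \<tau> x \<le> cdf \<eta> x"
      by (intro tendsto_lowerbound[OF right[OF N.finite_borel_measure_axioms]])
        (auto simp: eventually_at_filter)
    have "cdf \<eta> x \<le> cdf \<sigma> y + cdf \<tau> y" if "x < y" for y
    proof -
      have "cdf \<eta> x * (y - x) \<le> (cdf \<sigma> y + cdf \<tau> y) * (y - x)"
        using put_increment_cdf(2)[OF S that] put_increment_cdf(2)[OF T that]
          put_increment_cdf(1)[OF N that] put[of x] put[of y] by (simp add: algebra_simps)
      then show ?thesis
        using that by simp
    qed
    then show "cdf \<eta> x \<le> cdf \<sigma> x + cdf \<tau> x"
      by (intro tendsto_lowerbound[OF tendsto_add[OF right[OF S.finite_borel_measure_axioms]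
              right[OF T.finite_borel_measure_axioms]]])
        (auto simp: eventually_at_filter)
  qed
  have UNIV: "emeasure \<sigma> UNIV + emeasure \<tau> UNIV = emeasure \<eta> UNIV"
  proof -
    have "((\<lambda>x. cdf \<sigma> x + cdf \<tau> x) \<longlongrightarrow> measure \<sigma> UNIV + measure \<tau> UNIV) at_top"
      using S.cdf_lim_at_top T.cdf_lim_at_top
      by (intro tendsto_add) (simp_all add: S.borel_UNIV T.borel_UNIV)
    moreover have "((\<lambda>x. cdf \<sigma> x + cdf \<tau> x) \<longlongrightarrow> measure \<eta> UNIV) at_top"
      unfolding cdf using N.cdf_lim_at_top by (simp add: N.borel_UNIV)
    ultimately have "measure \<sigma> UNIV + measure \<tau> UNIV = measure \<eta> UNIV"
      by (intro tendsto_unique) auto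
    then show ?thesis
      by (simp add: S.emeasure_eq_measure T.emeasure_eq_measure N.emeasure_eq_measure
          flip: ennreal_plus)
  qed
  let ?G = "range (\<lambda>a::real. {..a})"
  have sigma: "sets borel = sigma_sets UNIV ?G"
    by (simp add: borel_eq_atMost)
  have "Int_stable ?G"
    by (auto simp: Int_stable_def)
  moreover have "?G \<subseteq> Pow UNIV"
    by simp
  moreover have "A \<in> sigma_sets UNIV ?G"
    using A by (simp add: sigma)
  ultimately show ?thesis
  proof (induction rule: sigma_sets_induct_disjoint)
    case (basic A)
    then obtain x where "A = {..x}" by auto
    then show ?case
      using cdf[of x]
      by (simp add: cdf_def S.emeasure_eq_measure T.emeasure_eq_measure N.emeasure_eq_measure
          flip: ennreal_plus)
  next
    case (compl A)
    then have A: "A \<in> sets borel" by (simp add: sigma)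
    have "emeasure M (UNIV - A) = emeasure M UNIV - emeasure M A" if "finite_borel_measure M" for M
    proof -
      interpret finite_borel_measure M by fact
      show ?thesis
        using emeasure_compl[of A M] A by (simp add: M_is_borel borel_UNIV)
    qed
    note this[OF S.finite_borel_measure_axioms] this[OF T.finite_borel_measure_axioms]
      this[OF N.finite_borel_measure_axioms]
    moreover have "emeasure \<sigma> A \<le> emeasure \<sigma> UNIV" "emeasure \<tau> A \<le> emeasure \<tau> UNIV"
      by (auto intro!: emeasure_mono simp: S.M_is_borel T.M_is_borel)
    ultimately show ?case
      using compl.IH UNIV
      by (simp add: S.emeasure_eq_measure T.emeasure_eq_measure N.emeasure_eq_measure
          ennreal_minus flip: ennreal_plus)
  next
    case (union A)
    then have A: "range A \<subseteq> sets borel" by (simp add: sigma)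
    have sums: "(\<Sum>i. emeasure M (A i)) = emeasure M (\<Union>i. A i)" if "sets M = sets borel" for M
      using A union that by (intro suminf_emeasure) auto
    have "(\<Sum>i. emeasure \<sigma> (A i)) + (\<Sum>i. emeasure \<tau> (A i)) = (\<Sum>i. emeasure \<eta> (A i))"
      unfolding union(3)[symmetric] by (rule suminf_add) auto
    then show ?case
      by (simp add: sums S.M_is_borel T.M_is_borel N.M_is_borel)
  qed auto
qed

lemma null_measure_moment: "null_measure borel \<in> \<M>"
  by (simp add: finite_moment_measures_def finite_measureI)

lemma put_null_measure [simp]: "put (null_measure borel) k = 0"
  by (simp add: put_def)

lemma measure_eq_of_put:
  assumes "\<sigma> \<in> \<M>" "\<eta> \<in> \<M>" "\<And>k. put \<sigma> k = put \<eta> k"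
  shows "\<sigma> = \<eta>"
proof (rule measure_eqI)
  show "sets \<sigma> = sets \<eta>"
    using assms by (simp add: finite_moment_measures_def)
  fix A assume "A \<in> sets \<sigma>"
  then have "A \<in> sets borel"
    using assms by (simp add: finite_moment_measures_def)
  then show "emeasure \<sigma> A = emeasure \<eta> A"
    using emeasure_add_eq_of_put[OF assms(1) null_measure_moment assms(2)] assms(3) by simp
qed

text \<open>
  The measure is the Stieltjes measure of the right derivative of \<open>f\<close>, so its distribution function
  is that derivative, and the increments of \<open>f\<close> are the integrals of the payoff increments \<open>inc\<close>.
  Monotone convergence at \<open>-\<infinity>\<close> then gives \<open>f\<close> as the put function. Monotone convergence at \<open>\<infinity>\<close>
  gives the call function at \<open>0\<close> from the asymptote, hence the first moment and the mean.
\<close>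

lemma convex_is_put:
  fixes f :: "real \<Rightarrow> real"
  assumes f: "convex_on UNIV f" and bot: "(f \<longlongrightarrow> 0) at_bot"
    and top: "((\<lambda>k. f k - m * k) \<longlongrightarrow> - b) at_top"
  obtains \<eta> where "\<eta> \<in> \<M>" "\<And>k. put \<eta> k = f k" "emeasure \<eta> UNIV = ennreal m" "mean \<eta> = b"
proof -
  define r where "r = right_deriv f"
  define \<eta> where "\<eta> = interval_measure r"
  have mono: "r x \<le> r y" if "x \<le> y" for x y
    unfolding r_def by (rule right_deriv_mono[OF f that])
  have cont: "continuous (at_right x) r" for x
    unfolding r_def by (rule continuous_at_right_right_deriv[OF f])
  have r_bot: "(r \<longlongrightarrow> 0) at_bot" and r_top: "(r \<longlongrightarrow> m) at_top"
    unfolding r_def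
    by (rule right_deriv_tendsto_at_bot[OF f bot], rule right_deriv_tendsto_at_top[OF f top])
  have r_ge: "0 \<le> r x" for x
    by (rule tendsto_upperbound[OF r_bot])
      (auto intro: eventually_mono[OF eventually_le_at_bot[of x]] mono)
  have r_le: "r x \<le> m" for x
    by (rule tendsto_lowerbound[OF r_top])
      (auto intro: eventually_mono[OF eventually_ge_at_top[of x]] mono)
  have sets[measurable_cong]: "sets \<eta> = sets borel"
    by (simp add: \<eta>_def)
  have Ioc: "emeasure \<eta> {x<..y} = ennreal (r y - r x)" if "x \<le> y" for x y
    unfolding \<eta>_def by (rule emeasure_interval_measure_Ioc[OF that mono cont])
  have "emeasure \<eta> UNIV \<le> ennreal m"
  proof (rule LIMSEQ_le_const2)
    show "(\<lambda>n. emeasure \<eta> {- real n<..real n}) \<longlonglongrightarrow> emeasure \<eta> UNIV"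
      unfolding UN_Ioc_eq_UNIV[symmetric]
      by (rule Lim_emeasure_incseq) (auto simp: sets incseq_def)
    show "\<exists>N. \<forall>n\<ge>N. emeasure \<eta> {- real n<..real n} \<le> ennreal m"
    proof (intro exI allI impI)
      fix n
      have "r (real n) - r (- real n) \<le> m"
        using r_le[of "real n"] r_ge[of "- real n"] by linarith
      then show "emeasure \<eta> {- real n<..real n} \<le> ennreal m"
        by (simp add: Ioc ennreal_leI)
    qed
  qed
  then have "emeasure \<eta> (space \<eta>) \<noteq> \<infinity>"
    by (auto simp: \<eta>_def top_unique)
  then interpret finite_borel_measure \<eta>
    by (intro finite_borel_measure.intro finite_measureI finite_borel_measure_axioms.intro sets)
  have cdf: "cdf \<eta> x = r x" for x
  proof -
    have diff: "cdf \<eta> y - cdf \<eta> x = r y - r x" if "x \<le> y" for x y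
    proof -
      have "ennreal (cdf \<eta> y - cdf \<eta> x) = ennreal (r y - r x)"
        using emeasure_Ioc[OF that] Ioc[OF that] by simp
      then show ?thesis
        using cdf_nondecreasing[OF that] mono[OF that] by simp
    qed
    have "((\<lambda>t. cdf \<eta> x - cdf \<eta> t) \<longlongrightarrow> cdf \<eta> x - 0) at_bot"
      by (intro tendsto_intros cdf_lim_at_bot)
    moreover have "((\<lambda>t. r x - r t) \<longlongrightarrow> r x - 0) at_bot"
      by (intro tendsto_intros r_bot)
    then have "((\<lambda>t. cdf \<eta> x - cdf \<eta> t) \<longlongrightarrow> r x - 0) at_bot"
      by (rule Lim_transform_eventually)
        (auto intro: eventually_mono[OF eventually_le_at_bot[of x]] simp: diff)
    ultimately show ?thesis
      using tendsto_unique[OF trivial_limit_at_bot_linorder] by fastforce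
  qed
  have mass: "measure \<eta> UNIV = m"
    using tendsto_unique[OF _ cdf_lim_at_top[unfolded cdf[abs_def]], of m] r_top
    by (simp add: borel_UNIV)
  define inc where "inc x y t = max (y - t) 0 - max (x - t) (0::real)" for x y t
  have inc_int: "integrable \<eta> (inc x y)" for x y
    unfolding inc_def[abs_def] by (rule integrable_put_increment)
  have inc_eq: "(\<integral>t. inc x y t \<partial>\<eta>) = f y - f x" for x y
  proof -
    define g where "g z = (\<integral>t. inc 0 z t \<partial>\<eta>)" for z
    have g: "g z - g w = (\<integral>t. inc w z t \<partial>\<eta>)" for w z
    proof -
      have "g z - g w = (\<integral>t. inc 0 z t - inc 0 w t \<partial>\<eta>)"
        unfolding g_def by (intro Bochner_Integration.integral_diff[symmetric] inc_int)
      then show ?thesis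
        by (simp add: inc_def)
    qed
    have "g y - g x = f y - f x"
    proof (rule increments_eq_of_mono_bounds[where r = r])
      fix x y :: real assume xy: "x < y"
      show "r x * (y - x) \<le> g y - g x" "g y - g x \<le> r y * (y - x)"
        unfolding g using put_increment_bounds[OF xy] by (simp_all add: cdf inc_def[abs_def])
      show "r x * (y - x) \<le> f y - f x" "f y - f x \<le> r y * (y - x)"
        unfolding r_def by (rule right_deriv_lower[OF f xy], rule right_deriv_upper[OF f xy])
    qed
    then show ?thesis
      by (simp add: g)
  qed
  have put: "integrable \<eta> (\<lambda>t. max (k - t) 0) \<and> (\<integral>t. max (k - t) 0 \<partial>\<eta>) = f k" for k
  proof (rule has_bochner_integral_iff[THEN iffD1], rule has_bochner_integral_monotone_convergence)
    show "integrable \<eta> (inc (- real n) k)" for n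
      by (rule inc_int)
    show "AE t in \<eta>. mono (\<lambda>n. inc (- real n) k t)"
      by (auto simp: mono_def inc_def)
    have "(\<lambda>n. inc (- real n) k t) \<longlonglongrightarrow> max (k - t) 0" for t
    proof (rule tendsto_eventually)
      show "\<forall>\<^sub>F n in sequentially. inc (- real n) k t = max (k - t) 0"
        using eventually_ge_at_top[of "nat \<lceil>- t\<rceil>"]
        by eventually_elim (auto simp: inc_def max_def nat_le_iff ceiling_le_iff)
    qed
    then show "AE t in \<eta>. (\<lambda>n. inc (- real n) k t) \<longlonglongrightarrow> max (k - t) 0"
      by simp
    have "(\<lambda>n. f (- real n)) \<longlonglongrightarrow> 0"
      by (rule filterlim_compose[OF bot])
        (rule filterlim_compose[OF filterlim_uminus_at_bot_at_top filterlim_real_sequentially])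
    from tendsto_diff[OF tendsto_const[of "f k"] this]
    show "(\<lambda>n. \<integral>t. inc (- real n) k t \<partial>\<eta>) \<longlonglongrightarrow> f k"
      by (simp add: inc_eq)
  qed measurable
  \<comment> \<open>The integrand \<open>n - inc 0 n t\<close> is the truncated call payoff \<open>min (max t 0) n\<close>.\<close>
  have call: "integrable \<eta> (\<lambda>t. max t 0) \<and> (\<integral>t. max t 0 \<partial>\<eta>) = b + f 0"
  proof (rule has_bochner_integral_iff[THEN iffD1], rule has_bochner_integral_monotone_convergence)
    have int: "integrable \<eta> (\<lambda>t. real n)" for n
      by simp
    show "integrable \<eta> (\<lambda>t. real n - inc 0 (real n) t)" for n
      using int inc_int by (rule Bochner_Integration.integrable_diff)
    show "AE t in \<eta>. mono (\<lambda>n. real n - inc 0 (real n) t)"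
      by (auto simp: mono_def inc_def max_def)
    have "(\<lambda>n. real n - inc 0 (real n) t) \<longlonglongrightarrow> max t 0" for t
    proof (rule tendsto_eventually)
      show "\<forall>\<^sub>F n in sequentially. real n - inc 0 (real n) t = max t 0"
        using eventually_ge_at_top[of "nat \<lceil>t\<rceil>"]
        by eventually_elim (auto simp: inc_def max_def nat_le_iff ceiling_le_iff)
    qed
    then show "AE t in \<eta>. (\<lambda>n. real n - inc 0 (real n) t) \<longlonglongrightarrow> max t 0"
      by simp
    have "(\<lambda>n. f (real n) - m * real n) \<longlonglongrightarrow> - b"
      by (rule filterlim_compose[OF top filterlim_real_sequentially])
    from tendsto_diff[OF tendsto_const[of "f 0"] this]
    have "(\<lambda>n. f 0 - (f (real n) - m * real n)) \<longlonglongrightarrow> b + f 0"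
      by (simp add: add.commute)
    moreover have "(\<integral>t. real n - inc 0 (real n) t \<partial>\<eta>) = f 0 - (f (real n) - m * real n)" for n
      by (subst Bochner_Integration.integral_diff[OF int inc_int])
        (simp add: inc_eq mass borel_UNIV)
    ultimately show "(\<lambda>n. \<integral>t. real n - inc 0 (real n) t \<partial>\<eta>) \<longlonglongrightarrow> b + f 0"
      by simp
  qed measurable
  have "integrable \<eta> (\<lambda>t. max t 0 + max (0 - t) 0)"
    using call[THEN conjunct1] put[THEN conjunct1] by (rule Bochner_Integration.integrable_add)
  moreover have "(\<lambda>t. max t 0 + max (0 - t) 0) = (\<lambda>t::real. \<bar>t\<bar>)"
    by (auto simp: fun_eq_iff max_def)
  ultimately have int: "integrable \<eta> (\<lambda>t. \<bar>t\<bar>)"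
    by simp
  have "\<eta> \<in> \<M>"
    using int finite_measure_axioms sets
    by (simp add: finite_moment_measures_def integrable_iff_bounded)
  moreover have "put \<eta> k = f k" for k
    using put by (simp add: put_def)
  moreover have "emeasure \<eta> UNIV = ennreal m"
    by (simp add: emeasure_eq_measure mass)
  moreover have "mean \<eta> = b"
    using put_minus_call[OF \<open>\<eta> \<in> \<M>\<close>, of 0] put[of 0] call by (simp add: put_def call_def)
  ultimately show ?thesis
    by (rule that)
qed

section \<open>Second distributional derivatives of put functions\<close>

lemma test_function_DERIV:
  assumes "test_function \<phi>"
  shows "((deriv ^^ n) \<phi> has_real_derivative (deriv ^^ Suc n) \<phi> x) (at x)"
  using assms
  by (auto simp: test_function_def differentiable_on_def DERIV_deriv_iff_real_differentiable)

lemma test_function_vanishes: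
  assumes "test_function \<phi>"
  obtains B where "0 \<le> B" "\<And>n x. B \<le> \<bar>x\<bar> \<Longrightarrow> (deriv ^^ n) \<phi> x = 0"
proof -
  have "bounded {x. \<phi> x \<noteq> 0}"
    using assms unfolding test_function_def
    by (intro bounded_subset[OF compact_imp_bounded closure_subset]) auto
  then obtain b where b: "\<And>x. \<phi> x \<noteq> 0 \<Longrightarrow> \<bar>x\<bar> \<le> b"
    by (auto simp: bounded_iff)
  have zero: "(deriv ^^ n) \<phi> x = 0" if "\<bar>b\<bar> < \<bar>x\<bar>" for n x
    using that
  proof (induction n arbitrary: x)
    case 0
    then show ?case
      using b[of x] by fastforce
  next
    case (Suc n)
    have "open {x. \<bar>b\<bar> < \<bar>x\<bar>}"
      by (intro open_Collect_less continuous_intros)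
    then have ev: "\<forall>\<^sub>F y in nhds x. (deriv ^^ n) \<phi> y = 0"
      using Suc by (auto simp: eventually_nhds)
    have "(deriv ^^ Suc n) \<phi> x = deriv (\<lambda>_. 0) x"
      using deriv_cong_ev[OF ev refl] by simp
    then show ?case
      by simp
  qed
  show ?thesis
    by (rule that[of "\<bar>b\<bar> + 1"]) (use zero in auto)
qed

text \<open>
  Integrating by parts twice shows that pairing \<open>\<lambda>k. max (k - x) 0\<close> with \<open>\<phi>''\<close> gives \<open>\<phi> x\<close>. By Fubini,
  pairing \<open>put \<eta>\<close> with \<open>\<phi>''\<close> then gives the integral of \<open>\<phi>\<close> with respect to \<open>\<eta>\<close>. The constant
  contributes nothing, because \<open>\<phi>''\<close> has integral \<open>0\<close>.
\<close>

lemma has_second_distributional_derivative_put: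
  assumes \<eta>: "\<eta> \<in> \<M>"
  shows "has_second_distributional_derivative (\<lambda>k. put \<eta> k + p) \<eta>"
proof -
  interpret finite_borel_measure \<eta>
    by (rule finite_borel_measure_of_moment[OF \<eta>])
  interpret P: pair_sigma_finite \<eta> lborel ..
  note [measurable_cong] = M_is_borel
  have cont: "continuous_on A (\<lambda>k. put \<eta> k + p)" for A
    using convex_on_continuous[OF open_UNIV convex_on_put[OF \<eta>]]
    by (auto intro!: continuous_intros intro: continuous_on_subset)
  have pairing: "(\<integral>k. (put \<eta> k + p) * (deriv ^^ 2) \<phi> k \<partial>lborel) = (\<integral>x. \<phi> x \<partial>\<eta>)"
    if \<phi>: "test_function \<phi>" for \<phi>
  proof -
    define \<phi>1 where "\<phi>1 = deriv \<phi>"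
    define \<phi>2 where "\<phi>2 = (deriv ^^ 2) \<phi>"
    have d0: "(\<phi> has_real_derivative \<phi>1 x) (at x)"
      and d1: "(\<phi>1 has_real_derivative \<phi>2 x) (at x)"
      and d2: "(\<phi>2 has_real_derivative (deriv ^^ 3) \<phi> x) (at x)" for x
      using test_function_DERIV[OF \<phi>, of 0 x] test_function_DERIV[OF \<phi>, of 1 x]
        test_function_DERIV[OF \<phi>, of 2 x]
      by (simp_all add: \<phi>1_def \<phi>2_def numeral_2_eq_2 numeral_3_eq_3)
    obtain B where B: "0 \<le> B" and zero: "\<And>n x. B \<le> \<bar>x\<bar> \<Longrightarrow> (deriv ^^ n) \<phi> x = 0"
      using test_function_vanishes[OF \<phi>] by blast
    have z0: "\<phi> x = 0" and z1: "\<phi>1 x = 0" and z2: "\<phi>2 x = 0" if "B \<le> \<bar>x\<bar>" for x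
      using zero[OF that, of 0] zero[OF that, of 1] zero[OF that, of 2]
      by (simp_all add: \<phi>1_def \<phi>2_def)
    have c2: "isCont \<phi>2 x" for x
      using d2 by (rule DERIV_isCont)
    then have c2': "continuous_on A \<phi>2" for A
      by (simp add: continuous_at_imp_continuous_on)
    have [measurable]: "\<phi>2 \<in> borel_measurable borel"
      by (rule borel_measurable_continuous_onI[OF c2'])
    have ind: "(\<lambda>k. indicator {- B..B} k * \<phi>2 k) = \<phi>2"
      using z2 by (auto simp: fun_eq_iff split: split_indicator)
    have int2: "integrable lborel \<phi>2"
      using borel_integrable_atLeastAtMost'[OF c2', of "- B" B] ind
      by (simp add: set_integrable_def)
    have total: "(\<integral>k. \<phi>2 k \<partial>lborel) = 0"
    proof -
      have "(\<integral>k. \<phi>2 k \<partial>lborel) = (\<integral>k. \<phi>2 k * indicator {- B..B} k \<partial>lborel)"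
        using ind by (simp add: mult.commute[of _ "indicator _ _"])
      also have "\<dots> = \<phi>1 B - \<phi>1 (- B)"
        using B d1 c2 by (intro integral_FTC_Icc_real) auto
      finally show ?thesis
        using z1[of B] z1[of "- B"] B by simp
    qed
    have kernel: "(\<integral>k. max (k - x) 0 * \<phi>2 k \<partial>lborel) = \<phi> x" for x
    proof -
      \<comment> \<open>Also for \<open>x > B\<close> the interval \<open>[x, C]\<close> contains the support of the integrand.\<close>
      define C where "C = max x B"
      have C: "x \<le> C" "B \<le> C"
        by (auto simp: C_def)
      have "max (k - x) 0 * \<phi>2 k = ((k - x) * \<phi>2 k) * indicator {x..C} k" for k
        using z2[of k] C by (auto split: split_indicator simp: max_def)
      then have "(\<integral>k. max (k - x) 0 * \<phi>2 k \<partial>lborel)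
          = (\<integral>k. ((k - x) * \<phi>2 k) * indicator {x..C} k \<partial>lborel)"
        by (rule Bochner_Integration.integral_cong[OF refl])
      also have "\<dots> = ((C - x) * \<phi>1 C - \<phi> C) - ((x - x) * \<phi>1 x - \<phi> x)"
        using C(1)
      proof (rule integral_FTC_Icc_real)
        show "((\<lambda>k. (k - x) * \<phi>1 k - \<phi> k) has_real_derivative (k - x) * \<phi>2 k) (at k)" for k
          by (auto intro!: derivative_eq_intros d0 d1)
        show "isCont (\<lambda>k. (k - x) * \<phi>2 k) k" for k
          by (intro continuous_intros c2)
      qed
      also have "\<dots> = \<phi> x"
        using z0[of C] z1[of C] B C by simp
      finally show ?thesis .
    qed
    have abs: "integrable \<eta> (\<lambda>x. \<bar>x\<bar> + B)"
      using integrable_of_moment(1)[OF \<eta>] by auto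
    \<comment> \<open>A dominating function of product form, valid because \<open>\<phi>2\<close> vanishes outside \<open>[-B, B]\<close>.\<close>
    have dom: "integrable (\<eta> \<Otimes>\<^sub>M lborel) (\<lambda>(x, k). (\<bar>x\<bar> + B) * \<bar>\<phi>2 k\<bar>)"
    proof (rule P.Fubini_integrable)
      show "AE x in \<eta>. integrable lborel (\<lambda>k. case (x, k) of (x, k) \<Rightarrow> (\<bar>x\<bar> + B) * \<bar>\<phi>2 k\<bar>)"
        using int2 by auto
      show "integrable \<eta> (\<lambda>x. \<integral>k. norm (case (x, k) of (x, k) \<Rightarrow> (\<bar>x\<bar> + B) * \<bar>\<phi>2 k\<bar>) \<partial>lborel)"
        using abs B by (simp add: abs_mult)
    qed measurable
    have int: "integrable (\<eta> \<Otimes>\<^sub>M lborel) (\<lambda>(x, k). max (k - x) 0 * \<phi>2 k)"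
    proof (rule Bochner_Integration.integrable_bound[OF dom])
      show "AE z in \<eta> \<Otimes>\<^sub>M lborel. norm (case z of (x, k) \<Rightarrow> max (k - x) 0 * \<phi>2 k)
          \<le> norm (case z of (x, k) \<Rightarrow> (\<bar>x\<bar> + B) * \<bar>\<phi>2 k\<bar>)"
      proof (rule AE_I2, clarify)
        fix x k
        show "norm (max (k - x) 0 * \<phi>2 k) \<le> norm ((\<bar>x\<bar> + B) * \<bar>\<phi>2 k\<bar>)"
        proof (cases "B \<le> \<bar>k\<bar>")
          case False
          then have "max (k - x) 0 \<le> \<bar>x\<bar> + B"
            using B by auto
          then show ?thesis
            using B by (auto simp: abs_mult intro!: mult_right_mono)
        qed (simp add: z2)
      qed
    qed measurable
    have put: "(\<integral>x. max (k - x) 0 * \<phi>2 k \<partial>\<eta>) = put \<eta> k * \<phi>2 k" for k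
      unfolding put_def by simp
    have int_put: "integrable lborel (\<lambda>k. put \<eta> k * \<phi>2 k)"
      using P.integrable_snd[OF int] by (simp add: put_def[abs_def])
    have "(\<integral>k. (put \<eta> k + p) * \<phi>2 k \<partial>lborel) = (\<integral>k. put \<eta> k * \<phi>2 k + p * \<phi>2 k \<partial>lborel)"
      by (simp add: distrib_right)
    also have "\<dots> = (\<integral>k. put \<eta> k * \<phi>2 k \<partial>lborel)"
      using int_put int2 total by simp
    also have "\<dots> = (\<integral>x. (\<integral>k. max (k - x) 0 * \<phi>2 k \<partial>lborel) \<partial>\<eta>)"
      unfolding put[symmetric] by (rule P.Fubini_integral[OF int])
    also have "\<dots> = (\<integral>x. \<phi> x \<partial>\<eta>)"
      by (simp add: kernel)
    finally show ?thesis
      by (simp add: \<phi>2_def)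
  qed
  have "emeasure \<eta> K < \<infinity>" for K
    by (simp add: emeasure_eq_measure)
  then show ?thesis
    unfolding has_second_distributional_derivative_def
    using pairing M_is_borel borel_integrable_atLeastAtMost'[OF cont] by blast
qed

section \<open>The shadow measure\<close>

theorem lemma5p2:
  fixes \<mu> \<nu> :: "real measure"
  assumes "\<mu> \<in> \<M>" and "\<nu> \<in> \<M>"
    and "emeasure \<mu> UNIV \<le> emeasure \<nu> UNIV"
  shows "\<exists>S. has_second_distributional_derivative
               (\<lambda>k. put \<nu> k - convex_minorant (\<lambda>x. put \<nu> x - put \<mu> x) k) S
           \<and> S \<in> submeasures \<mu> \<nu>
           \<and> (\<forall>k. put S k = put \<nu> k - convex_minorant (\<lambda>x. put \<nu> x - put \<mu> x) k - put_gap \<mu> \<nu>)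
           \<and> mean S = mean \<mu> + put_gap \<mu> \<nu> - call_gap \<mu> \<nu>
           \<and> (\<forall>\<theta>\<in>submeasures \<mu> \<nu>.
                (\<forall>k. put \<theta> k = put \<nu> k - convex_minorant (\<lambda>x. put \<nu> x - put \<mu> x) k - put_gap \<mu> \<nu>)
                \<and> mean \<theta> = mean \<mu> + put_gap \<mu> \<nu> - call_gap \<mu> \<nu> \<longrightarrow> \<theta> = S)"
proof -
  interpret mu: finite_borel_measure \<mu> by (rule finite_borel_measure_of_moment[OF assms(1)])
  interpret nu: finite_borel_measure \<nu> by (rule finite_borel_measure_of_moment[OF assms(2)])
  define D where "D k = put \<nu> k - put \<mu> k" for k
  define c where "c = convex_minorant D"
  define p where "p = put_gap \<mu> \<nu>"
  define q where "q = call_gap \<mu> \<nu>"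
  define L where "L = measure \<nu> UNIV - measure \<mu> UNIV"
  \<comment> \<open>The asymptote of \<open>D\<close> at \<open>\<infinity>\<close>.\<close>
  define A where "A k = L * k + (mean \<mu> - mean \<nu>)" for k
  have L: "0 \<le> L"
    using assms(3) by (simp add: L_def mu.emeasure_eq_measure nu.emeasure_eq_measure)
  have D_call: "D k = A k + (call \<nu> k - call \<mu> k)" for k
    unfolding D_def A_def L_def put_minus_call[OF assms(1)] put_minus_call[OF assms(2)]
    by (simp add: algebra_simps)

  have "bdd_above (range (\<lambda>k. put \<mu> k - put \<nu> k))"
  proof (rule bdd_aboveI2)
    fix k
    show "put \<mu> k - put \<nu> k \<le> max (put \<mu> 0) (mean \<nu> - mean \<mu> + call \<mu> 0)"
    proof (cases "k \<le> 0")
      case True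
      then show ?thesis
        using put_mono[OF assms(1) True] put_nonneg[of \<nu> k] by simp
    next
      case False
      then have "0 \<le> L * k"
        using L by simp
      then have "put \<mu> k - put \<nu> k \<le> mean \<nu> - mean \<mu> + call \<mu> 0"
        using False call_antimono[OF assms(1), of 0 k] call_nonneg[of \<nu> k] D_call[of k]
        unfolding D_def A_def by linarith
      then show ?thesis
        by simp
    qed
  qed
  note put_gap = cSUP_upper[OF UNIV_I this] less_cSUP_iff[OF UNIV_not_empty this]
  have p_le: "- p \<le> D k" for k
    using put_gap(1)[of k] by (simp add: p_def put_gap_def D_def)
  have p_inf: "\<exists>k. D k < - p + e" if "e > 0" for e
    using put_gap(2)[of "p - e"] that by (auto simp: p_def put_gap_def D_def algebra_simps)

  have "bdd_above (range (\<lambda>k. call \<mu> k - call \<nu> k))"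
  proof (rule bdd_aboveI2)
    fix k
    show "call \<mu> k - call \<nu> k \<le> max (call \<mu> 0) (mean \<mu> - mean \<nu> + put \<mu> 0)"
    proof (cases "k \<le> 0")
      case True
      then have "call \<mu> k - call \<nu> k \<le> mean \<mu> - mean \<nu> + put \<mu> 0"
        using put_mono[OF assms(1) True] put_nonneg[of \<nu> k] D_call[of k]
          mult_nonneg_nonpos[OF L True] unfolding D_def A_def by linarith
      then show ?thesis
        by simp
    next
      case False
      then show ?thesis
        using call_antimono[OF assms(1), of 0 k] call_nonneg[of \<nu> k] by simp
    qed
  qed
  note call_gap = cSUP_upper[OF UNIV_I this] less_cSUP_iff[OF UNIV_not_empty this]
  have q_le: "A k - q \<le> D k" for k
    using call_gap(1)[of k] by (simp add: q_def call_gap_def D_call)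
  have q_inf: "\<exists>k. D k - A k < - q + e" if "e > 0" for e
    using call_gap(2)[of "q - e"] that by (auto simp: q_def call_gap_def D_call algebra_simps)

  have const: "convex_on UNIV (\<lambda>_. - p)" "(\<lambda>_. - p) \<le> D"
    using p_le by (auto simp: le_fun_def convex_on_const)
  have c: "convex_on UNIV c"
    unfolding c_def by (rule convex_on_convex_minorant[OF const])
  have c_le: "c k \<le> D k" for k
    using convex_minorant_le[OF const] by (simp add: c_def le_fun_def)
  have c_ge: "g k \<le> c k" if "convex_on UNIV g" "\<And>k. g k \<le> D k" for g k
    using convex_minorant_greatest[OF const that(1)] that(2) by (simp add: c_def le_fun_def)
  have c_p: "- p \<le> c k" for k
    using c_ge[OF const(1)] p_le by simp
  have c_A: "A k - q \<le> c k" for k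
  proof -
    have "L * k + (mean \<mu> - mean \<nu> - q) \<le> D k" for k
      using q_le[of k] by (simp add: A_def)
    then have "L * k + (mean \<mu> - mean \<nu> - q) \<le> c k"
      by (rule c_ge[OF convex_on_UNIV_affine])
    then show ?thesis
      by (simp add: A_def)
  qed

  have c_bot: "(c \<longlongrightarrow> - p) at_bot"
  proof (rule convex_tendsto_Inf_at_bot[OF c])
    show "c k \<le> put \<nu> 0" if "k \<le> 0" for k
      using c_le[of k] put_nonneg[of \<mu> k] put_mono[OF assms(2) that] by (simp add: D_def)
    show "\<exists>k. c k < - p + e" if "e > 0" for e
      using p_inf[OF that] c_le by (meson le_less_trans)
  qed (rule c_p)
  have c_top: "((\<lambda>k. c k - A k) \<longlongrightarrow> - q) at_top"
  proof -
    have "((\<lambda>k. c (- k) - A (- k)) \<longlongrightarrow> - q) at_bot"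
    proof (rule convex_tendsto_Inf_at_bot)
      have "convex_on UNIV (\<lambda>k. c k - A k)"
        using convex_on_add_affine[OF c, of "- L" "mean \<nu> - mean \<mu>"]
        by (simp add: A_def algebra_simps)
      then show "convex_on UNIV (\<lambda>k. c (- k) - A (- k))"
        by (rule convex_on_reflect)
      show "c (- k) - A (- k) \<le> call \<nu> 0" if "k \<le> 0" for k
        using c_le[of "- k"] D_call[of "- k"] call_nonneg[of \<mu> "- k"]
          call_antimono[OF assms(2), of 0 "- k"] that by simp
      show "- q \<le> c (- k) - A (- k)" for k
        using c_A[of "- k"] by simp
      fix e :: real assume "e > 0"
      then obtain k where "D k - A k < - q + e"
        using q_inf by blast
      then show "\<exists>k. c (- k) - A (- k) < - q + e"
        using c_le[of k] by (intro exI[of _ "- k"]) auto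
    qed
    then show ?thesis
      by (simp add: filterlim_at_bot_mirror)
  qed

  have "convex_on UNIV (\<lambda>k. put \<nu> k - c k)"
    using convex_on_minus_convex_minorant[OF convex_on_put[OF assms(2)] convex_on_put[OF assms(1)]]
      const unfolding c_def D_def[abs_def] by blast
  then have "convex_on UNIV (\<lambda>k. put \<nu> k - c k + (0 * k + - p))"
    by (rule convex_on_add_affine)
  then have S_cvx: "convex_on UNIV (\<lambda>k. put \<nu> k - c k - p)"
    by simp
  have S_bot: "((\<lambda>k. put \<nu> k - c k - p) \<longlongrightarrow> 0) at_bot"
    using tendsto_diff[OF tendsto_diff[OF put_tendsto_at_bot[OF assms(2)] c_bot] tendsto_const[of p]]
    by simp
  have "((\<lambda>k. call \<nu> k - (c k - A k) - (mean \<mu> + p)) \<longlongrightarrow> 0 - (- q) - (mean \<mu> + p)) at_top"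
    by (intro tendsto_diff tendsto_const call_tendsto_at_top assms(2) c_top)
  moreover have "call \<nu> k - (c k - A k) - (mean \<mu> + p) = put \<nu> k - c k - p - measure \<mu> UNIV * k" for k
    unfolding put_minus_call[OF assms(2)] by (simp add: A_def L_def algebra_simps)
  moreover have "0 - (- q) - (mean \<mu> + p) = - (mean \<mu> + p - q)"
    by simp
  ultimately have S_top:
    "((\<lambda>k. put \<nu> k - c k - p - measure \<mu> UNIV * k) \<longlongrightarrow> - (mean \<mu> + p - q)) at_top"
    by (simp only:)
  obtain S where S: "S \<in> \<M>" "\<And>k. put S k = put \<nu> k - c k - p"
      "emeasure S UNIV = ennreal (measure \<mu> UNIV)" "mean S = mean \<mu> + p - q"
    by (rule convex_is_put[OF S_cvx S_bot S_top]) blast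

  \<comment> \<open>The complement of \<open>S\<close> in \<open>\<nu>\<close>, obtained from \<open>c\<close> rather than by subtracting measures.\<close>
  have "convex_on UNIV (\<lambda>k. c k + (0 * k + p))"
    by (rule convex_on_add_affine[OF c])
  then have T_cvx: "convex_on UNIV (\<lambda>k. c k + p)"
    by simp
  have T_bot: "((\<lambda>k. c k + p) \<longlongrightarrow> 0) at_bot"
    using tendsto_add[OF c_bot tendsto_const[of p]] by simp
  have "((\<lambda>k. c k - A k + (mean \<mu> - mean \<nu> + p)) \<longlongrightarrow> - q + (mean \<mu> - mean \<nu> + p)) at_top"
    by (intro tendsto_add tendsto_const c_top)
  then have T_top: "((\<lambda>k. c k + p - L * k) \<longlongrightarrow> - (q - (mean \<mu> - mean \<nu> + p))) at_top"
    by (simp add: A_def algebra_simps)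
  obtain T where T: "T \<in> \<M>" "\<And>k. put T k = c k + p"
    by (rule convex_is_put[OF T_cvx T_bot T_top]) blast

  have "emeasure S B \<le> emeasure \<nu> B" if "B \<in> sets borel" for B
  proof -
    have "emeasure S B + emeasure T B = emeasure \<nu> B"
      using that by (intro emeasure_add_eq_of_put[OF S(1) T(1) assms(2)]) (simp_all add: S T)
    then show ?thesis
      by (metis le_iff_add)
  qed
  then have "S \<in> submeasures \<mu> \<nu>"
    by (simp add: submeasures_def S mu.emeasure_eq_measure)
  moreover have "has_second_distributional_derivative (\<lambda>k. put \<nu> k - c k) S"
    using has_second_distributional_derivative_put[OF S(1), of p] by (simp add: S(2))
  moreover have "\<theta> = S" if "\<theta> \<in> submeasures \<mu> \<nu>" "\<forall>k. put \<theta> k = put \<nu> k - c k - p" for \<theta>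
    using that by (intro measure_eq_of_put[OF _ S(1)]) (auto simp: submeasures_def S(2))
  ultimately show ?thesis
    unfolding p_def[symmetric] q_def[symmetric] D_def[abs_def, symmetric] c_def[symmetric]
    using S(2,4) by blast
qed

end
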